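(* Let $n\ge 1$, let $M_{\mathrm{HL},b}$ denote the uncentered Hardy-Littlewood maximal operator defined with respect to balls in $\mathbb{R}^n$, and let $C_{\mathrm{HL},b}(\alpha)$, $0<\alpha<1$, be its sharp Tauberian constants. Then $$\lim_{\alpha\to 1^-} C_{\mathrm{HL},b}(\alpha) = 1.$$ In particular, $$C_{\mathrm{HL},b}(\alpha) - 1 \lesssim_n \Big(\frac{1}{\alpha}-1\Big)^{\frac{1}{n+1}}\quad\text{as } \alpha\to 1^-,$$ that is, there exist a constant $c_n>0$ and a number $\alpha_n\in(0,1)$, depending only on $n$, such that $C_{\mathrm{HL},b}(\alpha) - 1 \le c_n \left(\frac{1}{\alpha}-1\right)^{\frac{1}{n+1}}$ for all $\alpha\in(\alpha_n,1)$.
   Context: $|\cdot|$ denotes Lebesgue measure on $\mathbb{R}^n$ and $\chi_E$ the indicator function of $E$. The uncentered Hardy-Littlewood maximal operator with respect to balls is $$M_{\mathrm{HL},b}f(x) = \sup_{B\ni x}\frac{1}{|B|}\int_B |f|,$$ where the supremum is over all open Euclidean balls $B\subset\mathbb{R}^n$ (of any center and positive radius) containing $x$. Its sharp Tauberian constant associated to $\alpha\in(0,1)$ is $$C_{\mathrm{HL},b}(\alpha) = \sup_{E}\frac{1}{|E|}\big|\{x\in\mathbb{R}^n : M_{\mathrm{HL},b}\chi_E(x)>\alpha\}\big|,$$ where the supremum is over all measurable $E\subset\mathbb{R}^n$ with $0<|E|<\infty$. *)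

theory Defs
  imports "HOL-Analysis.Analysis"
begin

text \<open>
  The norm on \<open>real ^ 'n\<close> is the Euclidean one, so \<open>ball c r\<close> is an open Euclidean ball.
  Averages and suprema are taken in \<open>ennreal\<close>, where \<open>Sup\<close> is total and the value \<open>\<infinity>\<close> is not
  conflated with a real number.
\<close>

definition HL_maximal :: "(real ^ 'n \<Rightarrow> real) \<Rightarrow> real ^ 'n \<Rightarrow> ennreal" where
  "HL_maximal f x =
     (SUP B \<in> {ball c r | c r. 0 < r \<and> x \<in> ball c r}.
        (\<integral>\<^sup>+ y \<in> B. ennreal \<bar>f y\<bar> \<partial>lebesgue) / emeasure lebesgue B)"

definition HL_superlevel :: "(real ^ 'n) set \<Rightarrow> real \<Rightarrow> (real ^ 'n) set" where
  "HL_superlevel E \<alpha> = {x. HL_maximal (indicator E) x > ennreal \<alpha>}"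

text \<open>
  Superlevel sets are open, hence measurable: the convention that \<open>emeasure\<close> vanishes on
  non-measurable sets plays no role in the definition of the Tauberian constant below.
\<close>

lemma open_HL_superlevel: "open (HL_superlevel E \<alpha>)"
proof -
  let ?avg = "\<lambda>B. (\<integral>\<^sup>+ y \<in> B. ennreal \<bar>indicator E y\<bar> \<partial>lebesgue) / emeasure lebesgue B"
  have "HL_superlevel E \<alpha> = \<Union> {ball c r | c r. 0 < r \<and> ennreal \<alpha> < ?avg (ball c r)}"
    unfolding HL_superlevel_def HL_maximal_def less_SUP_iff by blast
  also have "open \<dots>"
    by (rule open_Union) auto
  finally show ?thesis .
qed

definition HL_tauberian :: "'n::finite itself \<Rightarrow> real \<Rightarrow> ennreal" where
  "HL_tauberian _ \<alpha> =
     (SUP E \<in> {E :: (real ^ 'n) set. E \<in> sets lebesgue \<and> 0 < emeasure lebesgue E \<and>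
                                      emeasure lebesgue E < \<infinity>}.
        emeasure lebesgue (HL_superlevel E \<alpha>) / emeasure lebesgue E)"

end

theory Submission
  imports Defs
begin

text \<open>
  Let the superlevel set of \<open>E\<close> be exhausted by compact sets. Such a compact set is covered by
  finitely many balls in each of which \<open>E\<close> has density at least \<open>\<alpha>\<close>, so the task is to bound the
  measure of a finite union of such balls by nearly \<open>\<bar>E\<bar>\<close>. Summing over the balls directly is
  hopeless, because they may overlap heavily: every ball contributes up to \<open>1 - \<alpha>\<close> of its measure
  outside \<open>E\<close>.

  Fix \<open>0 < s \<le> 1\<close>. Running through the balls by decreasing radius, one keeps a ball only if at least
  the fraction \<open>s\<^sup>n\<close> of it is not covered by the balls kept before (\<open>sparse_subfamily\<close>). There are two
  consequences.

  \<^item> The measures of the kept balls sum to at most \<open>s\<close> to the power \<open>-n\<close> times the measure of their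
    union \<open>U\<close>. Hence at most \<open>(1 - \<alpha>) \<bar>U\<bar> / s\<^sup>n\<close> of \<open>U\<close> lies outside \<open>E\<close>.

  \<^item> The part of a discarded ball of radius \<open>r\<close> that the larger kept balls miss has less than the
    fraction \<open>s\<^sup>n\<close> of its measure, too little to contain a ball of radius \<open>s r\<close>. All points of the
    discarded ball are therefore within \<open>2 s r\<close> of a kept
    ball of radius at least \<open>r\<close> (\<open>nearly_covered_ball_near\<close>). So the kept balls, dilated by
    \<open>1 + 2 s\<close>, cover everything.

  Dilating all balls of a family about their centres by \<open>t > 1\<close> multiplies the measure of the union
  by at most \<open>t\<^sup>n\<close> (\<open>measure_union_balls_dilate\<close>), however the balls overlap. It is essential here that
  the constant tends to \<open>1\<close> as \<open>t\<close> does; passing to a disjoint subfamily, as in Vitali's covering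
  lemma, would lose a fixed factor.

  Together, the union has measure at most \<open>(1 + 2 s)\<^sup>n \<bar>E\<bar> / (1 - (1 - \<alpha>) / s\<^sup>n)\<close>. The two losses are
  of the orders \<open>s\<close> and \<open>(1 - \<alpha>) / s\<^sup>n\<close>. They balance when \<open>s\<close> to the power \<open>n + 1\<close> is \<open>1 / \<alpha> - 1\<close>,
  which is where the exponent comes from. The limit follows, since the Tauberian constant is at
  least \<open>1\<close>.
\<close>

section \<open>Dilating a union of balls\<close>

text \<open>
  A ball is recorded as a pair of centre and radius: dilation about the centre and the selection by
  radius refer to data that the ball as a set need not determine.
\<close>
definition union_balls :: "real \<Rightarrow> ('a::metric_space \<times> real) set \<Rightarrow> 'a set" where
  "union_balls t F = (\<Union>(c, r)\<in>F. ball c (t * r))"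

lemma lmeasurable_union_balls:
  fixes F :: "('a::euclidean_space \<times> real) set"
  assumes "finite F"
  shows "union_balls t F \<in> lmeasurable"
  unfolding union_balls_def using assms by (intro fmeasurable.finite_UN) auto

text \<open>The power of a point with respect to a sphere; for a positive radius, it is negative exactly
  inside the ball.\<close>
definition power_dist :: "'a::real_normed_vector \<Rightarrow> 'a \<times> real \<Rightarrow> real" where
  "power_dist y p = (norm (y - fst p))\<^sup>2 - (snd p)\<^sup>2"

text \<open>
  The dilations about \<open>c\<close> and \<open>d\<close> send a point \<open>z\<close> to two points. If each of these lies in the cell
  of its own centre in the power diagram of the dilated balls, then the two inequalities that say
  so add up to \<open>0 \<le> 2 (1 - t) \<bar>c - d\<bar>\<^sup>2\<close>. Thus shrinking every cell towards its centre gives disjoint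
  sets. The power diagram is the right partition for this because the terms that depend on the
  radii cancel in the sum.
\<close>
lemma power_dist_dilated_cells_disjoint:
  fixes z c d :: "'a::real_inner"
  assumes t: "t > 1" and r: "r > 0" and s: "s > 0"
    and c: "power_dist (c + t *\<^sub>R (z - c)) (c, t * r) \<le> power_dist (c + t *\<^sub>R (z - c)) (d, t * s)"
    and d: "power_dist (d + t *\<^sub>R (z - d)) (d, t * s) \<le> power_dist (d + t *\<^sub>R (z - d)) (c, t * r)"
  shows "(c, r) = (d, s)"
proof -
  define u where "u = z - c"
  define w where "w = z - d"
  have eqs: "c + t *\<^sub>R (z - c) - d = t *\<^sub>R w + (1 - t) *\<^sub>R (w - u)"
    "d + t *\<^sub>R (z - d) - c = t *\<^sub>R u + (1 - t) *\<^sub>R (u - w)"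
    by (simp_all add: u_def w_def algebra_simps)
  have "(norm (t *\<^sub>R u))\<^sup>2 - (t * r)\<^sup>2 \<le> (norm (t *\<^sub>R w + (1 - t) *\<^sub>R (w - u)))\<^sup>2 - (t * s)\<^sup>2"
    using c unfolding power_dist_def eqs(1)[symmetric] by (simp add: u_def)
  moreover have "(norm (t *\<^sub>R w))\<^sup>2 - (t * s)\<^sup>2 \<le> (norm (t *\<^sub>R u + (1 - t) *\<^sub>R (u - w)))\<^sup>2 - (t * r)\<^sup>2"
    using d unfolding power_dist_def eqs(2)[symmetric] by (simp add: w_def)
  ultimately have "0 \<le> (norm (t *\<^sub>R w + (1 - t) *\<^sub>R (w - u)))\<^sup>2 - (norm (t *\<^sub>R w))\<^sup>2
      + ((norm (t *\<^sub>R u + (1 - t) *\<^sub>R (u - w)))\<^sup>2 - (norm (t *\<^sub>R u))\<^sup>2)"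
    by linarith
  also have "\<dots> = 2 * (1 - t) * (norm (w - u))\<^sup>2"
    unfolding power2_norm_eq_inner by (simp add: inner_commute power2_eq_square algebra_simps)
  finally have "(norm (w - u))\<^sup>2 \<le> 0"
    using t by (simp add: zero_le_mult_iff)
  then have "c = d" by (simp add: u_def w_def)
  with c d have "(t * r)\<^sup>2 = (t * s)\<^sup>2"
    by (simp add: power_dist_def)
  then show ?thesis
    using t r s \<open>c = d\<close> by (simp add: power_mult_distrib)
qed

text \<open>
  Cut the dilated union into the power cells of its balls. Shrinking each cell by \<open>1 / t\<close> towards its
  centre puts it into the original ball and divides its measure by \<open>t\<close> to the dimension, and the
  shrunken cells are disjoint.
\<close>
lemma measure_union_balls_dilate:
  fixes F :: "('a::euclidean_space \<times> real) set"
  assumes F: "finite F" and pos: "\<And>p. p \<in> F \<Longrightarrow> snd p > 0" and t: "t > 1"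
  shows "measure lebesgue (union_balls t F) \<le> t ^ DIM('a) * measure lebesgue (union_balls 1 F)"
proof -
  let ?dil = "\<lambda>p. (fst p, t * snd p)"
  \<comment> \<open>\<open>A p\<close> is the closed power cell of the dilated ball \<open>p\<close>, inside that ball; ties are harmless, as
    the cells only need to cover and only the shrunken cells \<open>Z p\<close> need to be disjoint.\<close>
  define A where "A p = ball (fst p) (t * snd p) \<inter>
      (\<Inter>q\<in>F. {y. power_dist y (?dil p) \<le> power_dist y (?dil q)})" for p :: "'a \<times> real"
  define T where "T p z = t *\<^sub>R z + (1 - t) *\<^sub>R fst p" for p :: "'a \<times> real" and z
  define Z where "Z p = T p -` A p" for p
  have T_eq: "T p z = fst p + t *\<^sub>R (z - fst p)" for p z
    by (simp add: T_def algebra_simps)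
  have cont: "continuous_on UNIV (T p)" for p
    unfolding T_def by (intro continuous_intros)
  have borel_A: "A p \<in> sets borel" for p
  proof -
    have "closed (\<Inter>q\<in>F. {y. power_dist y (?dil p) \<le> power_dist y (?dil q)})"
      unfolding power_dist_def by (intro closed_INT ballI closed_Collect_le continuous_intros)
    then show ?thesis unfolding A_def by auto
  qed
  have Z_sub: "Z p \<subseteq> ball (fst p) (snd p)" for p
  proof
    fix z assume "z \<in> Z p"
    then have "norm (t *\<^sub>R (z - fst p)) < t * snd p"
      by (auto simp: Z_def A_def T_eq dist_norm)
    then show "z \<in> ball (fst p) (snd p)"
      using t by (simp add: dist_norm norm_minus_commute)
  qed
  have borel_Z: "Z p \<in> sets borel" for p
  proof -
    have "T p \<in> borel_measurable borel"
      using cont by (rule borel_measurable_continuous_onI)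
    from measurable_sets[OF this borel_A] show ?thesis by (simp add: Z_def)
  qed
  have Z_meas: "Z p \<in> lmeasurable" for p
    by (rule fmeasurableI2[OF lmeasurable_ball Z_sub]) (use borel_Z in simp)
  have A_eq: "A p = T p ` Z p" for p
  proof -
    have "y = T p ((1/t) *\<^sub>R (y - (1 - t) *\<^sub>R fst p))" for y
      using t by (simp add: T_def)
    then show ?thesis unfolding Z_def by auto
  qed
  have A_measure: "measure lebesgue (A p) = t ^ DIM('a) * measure lebesgue (Z p)" for p
    using measure_lebesgue_affine[of t "(1 - t) *\<^sub>R fst p" "Z p"] t
    by (simp add: A_eq T_def[abs_def])
  have cover: "union_balls t F \<subseteq> (\<Union>p\<in>F. A p)"
  proof
    fix y assume "y \<in> union_balls t F"
    then obtain p where p: "p \<in> F" "y \<in> ball (fst p) (t * snd p)"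
      unfolding union_balls_def by auto
    obtain q where q: "q \<in> F" "\<And>p. p \<in> F \<Longrightarrow> power_dist y (?dil q) \<le> power_dist y (?dil p)"
    proof (rule that)
      let ?q = "arg_min_on (\<lambda>q. power_dist y (?dil q)) F"
      show "?q \<in> F" using F p(1) by (intro arg_min_if_finite) auto
      show "power_dist y (?dil ?q) \<le> power_dist y (?dil p)" if "p \<in> F" for p
        using F that by (intro arg_min_least) auto
    qed
    have sp: "snd p > 0" "snd q > 0"
      using pos p(1) q(1) by auto
    \<comment> \<open>The minimal power is negative, so \<open>y\<close> lies inside the ball that attains it.\<close>
    have "power_dist y (?dil p) < 0"
      using p(2) sp t by (simp add: power_dist_def dist_norm norm_minus_commute power_strict_mono)
    then have "(norm (y - fst q))\<^sup>2 < (t * snd q)\<^sup>2"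
      using q(2)[OF p(1)] by (simp add: power_dist_def)
    then have "norm (y - fst q) < t * snd q"
      by (rule power2_less_imp_less) (use sp t in simp)
    then have "y \<in> A q"
      using q by (auto simp: A_def dist_norm norm_minus_commute)
    then show "y \<in> (\<Union>p\<in>F. A p)" using q(1) by blast
  qed
  have disj: "pairwise (\<lambda>p q. disjnt (Z p) (Z q)) F"
    unfolding pairwise_def
  proof (intro ballI impI)
    fix p q assume pq: "p \<in> F" "q \<in> F" "p \<noteq> q"
    have "False" if "z \<in> Z p" "z \<in> Z q" for z
    proof -
      have "(fst p, snd p) = (fst q, snd q)"
      proof (rule power_dist_dilated_cells_disjoint[OF t, where z = z])
        show "0 < snd p" "0 < snd q" 
          using pos pq by auto
      qed (use that pq in \<open>auto simp: Z_def A_def T_eq\<close>)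
      with pq show False by (simp add: prod_eq_iff)
    qed
    then show "disjnt (Z p) (Z q)" by (auto simp: disjnt_def)
  qed
  have A_sets: "A p \<in> sets lebesgue" for p using borel_A by simp
  have A_fm: "A p \<in> lmeasurable" for p
    by (rule fmeasurableI2[of "ball (fst p) (t * snd p)"]) (use A_sets in \<open>auto simp: A_def\<close>)
  have "measure lebesgue (union_balls t F) \<le> measure lebesgue (\<Union>p\<in>F. A p)"
    by (rule measure_mono_fmeasurable[OF cover])
      (use F A_fm lmeasurable_union_balls[OF F, of t] in \<open>auto intro!: fmeasurable.finite_UN\<close>)
  also have "\<dots> \<le> (\<Sum>p\<in>F. measure lebesgue (A p))"
    by (rule measure_UNION_le[OF F A_sets])
  also have "\<dots> = t ^ DIM('a) * measure lebesgue (\<Union>p\<in>F. Z p)"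
    using measure_UNION'[OF F Z_meas disj] by (simp add: A_measure sum_distrib_left)
  also have "measure lebesgue (\<Union>p\<in>F. Z p) \<le> measure lebesgue (union_balls 1 F)"
  proof (rule measure_mono_fmeasurable)
    show "(\<Union>p\<in>F. Z p) \<subseteq> union_balls 1 F"
      using Z_sub by (fastforce simp: union_balls_def)
    show "(\<Union>p\<in>F. Z p) \<in> sets lebesgue" using F Z_meas by auto
  qed (rule lmeasurable_union_balls[OF F])
  finally show ?thesis using t by (simp add: mult_left_mono)
qed

section \<open>Selecting a sparse subfamily\<close>

text \<open>
  The greedy choice by decreasing radius. A kept ball adds at least \<open>\<epsilon>\<close> of its measure to the union,
  which gives the bound on the sum. A discarded ball is nearly covered by the balls kept before it,
  all of which are at least as large; later choices only enlarge that cover.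
\<close>
lemma sparse_subfamily:
  fixes F :: "('a::euclidean_space \<times> real) set"
  assumes "finite F"
  shows "\<exists>G\<subseteq>F. \<epsilon> * (\<Sum>(c, r)\<in>G. measure lebesgue (ball c r)) \<le> measure lebesgue (union_balls 1 G) \<and>
    (\<forall>c r. (c, r) \<in> F \<longrightarrow> measure lebesgue (ball c r - union_balls 1 {g \<in> G. r \<le> snd g})
        < \<epsilon> * measure lebesgue (ball c r) \<or> (c, r) \<in> G)"
  using assms
proof (induction F rule: finite_ranking_induct[where f = "\<lambda>p. - snd p"])
  case empty
  then show ?case by simp
next
  case (insert p S)
  obtain c r where p: "p = (c, r)" by force
  obtain G where G: "G \<subseteq> S"
    "\<epsilon> * (\<Sum>(c, r)\<in>G. measure lebesgue (ball c r)) \<le> measure lebesgue (union_balls 1 G)"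
    "\<And>c r. (c, r) \<in> S \<Longrightarrow> measure lebesgue (ball c r - union_balls 1 {g \<in> G. r \<le> snd g})
        < \<epsilon> * measure lebesgue (ball c r) \<or> (c, r) \<in> G"
    using insert.IH by (elim exE conjE) (rule that, assumption, assumption, simp)
  have finG: "finite G" using G(1) insert.hyps(1) finite_subset by blast
  \<comment> \<open>\<open>p\<close> has the smallest radius so far, so the restriction to larger balls is void.\<close>
  have large: "{g \<in> G. r \<le> snd g} = G"
    using insert.hyps(2) G(1) p by fastforce
  show ?case
  proof (cases "p \<in> G \<or> measure lebesgue (ball c r - union_balls 1 G) < \<epsilon> * measure lebesgue (ball c r)")
    case True
    then show ?thesis
      using G large p by (intro exI[of _ G] conjI allI impI) auto
  next
    case False
    have fm: "union_balls 1 G \<in> lmeasurable" by (rule lmeasurable_union_balls[OF finG])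
    have "union_balls 1 (insert p G) = union_balls 1 G \<union> (ball c r - union_balls 1 G)"
      by (auto simp: union_balls_def p)
    also have "measure lebesgue \<dots> = measure lebesgue (union_balls 1 G) + measure lebesgue (ball c r - union_balls 1 G)"
      by (rule measure_Un_AE) (use fm in \<open>auto intro!: fmeasurable.Diff fmeasurableD\<close>)
    finally have "\<epsilon> * (\<Sum>(c, r)\<in>insert p G. measure lebesgue (ball c r)) \<le> measure lebesgue (union_balls 1 (insert p G))"
      using G(2) False finG by (simp add: p algebra_simps)
    moreover have "measure lebesgue (ball a s - union_balls 1 {g \<in> insert p G. s \<le> snd g})
        < \<epsilon> * measure lebesgue (ball a s) \<or> (a, s) \<in> insert p G" if as: "(a, s) \<in> insert p S" for a s
    proof (cases "(a, s) \<in> insert p G")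
      case nin: False
      have "measure lebesgue (ball a s - union_balls 1 {g \<in> insert p G. s \<le> snd g})
          \<le> measure lebesgue (ball a s - union_balls 1 {g \<in> G. s \<le> snd g})"
        by (rule measure_mono_fmeasurable)
          (use finG lmeasurable_union_balls[of "{g \<in> G. s \<le> snd g}" 1]
               lmeasurable_union_balls[of "{g \<in> insert p G. s \<le> snd g}" 1]
           in \<open>auto simp: union_balls_def intro!: fmeasurable.Diff sets.Diff fmeasurableD\<close>)
      with G(3)[of a s] as nin show ?thesis by auto
    qed simp
    ultimately show ?thesis
      using G(1) by (intro exI[of _ "insert p G"] conjI allI impI) auto
  qed
qed

lemma measure_lebesgue_ball_scale:
  fixes z c :: "'a::euclidean_space"
  assumes "r \<ge> 0" "s \<ge> 0"
  shows "measure lebesgue (ball z (s * r)) = s ^ DIM('a) * measure lebesgue (ball c r)"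
  using assms by (simp add: content_ball power_mult_distrib)

text \<open>
  Moving \<open>x\<close> towards \<open>c\<close> by the fraction \<open>s\<close> of its distance gives the centre of a ball of radius
  \<open>s r\<close> inside \<open>ball c r\<close>. The part missed by \<open>U\<close> is too small to contain it.
\<close>
lemma nearly_covered_ball_near:
  fixes c x :: "'a::euclidean_space"
  assumes s: "0 < s" "s \<le> 1" and x: "x \<in> ball c r" and U: "U \<in> sets lebesgue"
    and small: "measure lebesgue (ball c r - U) < s ^ DIM('a) * measure lebesgue (ball c r)"
  shows "\<exists>u\<in>U. dist u x < 2 * s * r"
proof -
  have r: "r > 0" using x by (metis dist_not_less_zero mem_ball not_less_iff_gr_or_eq order_less_trans)
  define z where "z = c + (1 - s) *\<^sub>R (x - c)"
  have xc: "norm (x - c) < r" using x by (simp add: dist_norm norm_minus_commute)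
  have "x - z = s *\<^sub>R (x - c)" by (simp add: z_def algebra_simps)
  then have zx: "dist z x < s * r"
    using s xc by (simp add: dist_norm norm_minus_commute)
  have "dist c z \<le> (1 - s) * r"
    using s xc by (auto simp: z_def dist_norm intro!: mult_left_mono)
  then have sub: "ball z (s * r) \<subseteq> ball c r"
    by (subst ball_subset_ball_iff) (auto simp: dist_commute algebra_simps)
  have "\<not> ball z (s * r) \<inter> U = {}"
  proof
    assume "ball z (s * r) \<inter> U = {}"
    then have "measure lebesgue (ball z (s * r)) \<le> measure lebesgue (ball c r - U)"
      using sub U by (intro measure_mono_fmeasurable) (auto intro!: fmeasurable_Diff)
    with small measure_lebesgue_ball_scale[of r s z c] r s show False by simp
  qed
  then obtain u where u: "u \<in> U" "dist z u < s * r" by auto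
  have "dist u x \<le> dist z u + dist z x" by (metis dist_commute dist_triangle)
  with u zx show ?thesis by force
qed

section \<open>The Tauberian estimate\<close>

text \<open>
  The selected balls \<open>G\<close> are comparable with \<open>F\<close> after dilation, and being sparse they spill little
  out of \<open>E\<close>. The parameter \<open>s\<close> is left free: a small \<open>s\<close> makes the dilation cheap and the spill
  expensive.
\<close>
lemma measure_union_balls_dense_in:
  fixes F :: "('a::euclidean_space \<times> real) set"
  assumes F: "finite F" and pos: "\<And>p. p \<in> F \<Longrightarrow> snd p > 0"
    and E: "E \<in> lmeasurable"
    and dense: "\<And>c r. (c, r) \<in> F \<Longrightarrow> \<alpha> * measure lebesgue (ball c r) \<le> measure lebesgue (E \<inter> ball c r)"
    and s: "0 < s" "s \<le> 1" and \<alpha>: "\<alpha> \<le> 1" and loss: "1 - \<alpha> \<le> s ^ DIM('a)"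
  shows "(1 - (1 - \<alpha>) / s ^ DIM('a)) * measure lebesgue (union_balls 1 F)
    \<le> (1 + 2 * s) ^ DIM('a) * measure lebesgue E"
proof -
  let ?\<mu> = "measure (lebesgue :: 'a measure)"
  obtain G where G: "G \<subseteq> F"
    "s ^ DIM('a) * (\<Sum>(c, r)\<in>G. ?\<mu> (ball c r)) \<le> ?\<mu> (union_balls 1 G)"
    "\<And>c r. (c, r) \<in> F \<Longrightarrow> ?\<mu> (ball c r - union_balls 1 {g \<in> G. r \<le> snd g})
        < s ^ DIM('a) * ?\<mu> (ball c r) \<or> (c, r) \<in> G"
    using sparse_subfamily[OF F, of "s ^ DIM('a)"]
    by (elim exE conjE) (rule that, assumption, assumption, simp)
  have finG: "finite G" using G(1) F finite_subset by blast
  note fmG = lmeasurable_union_balls[OF finG]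
  have "union_balls 1 F \<subseteq> union_balls (1 + 2 * s) G"
  proof
    fix x assume "x \<in> union_balls 1 F"
    then obtain c r where cr: "(c, r) \<in> F" "x \<in> ball c r" unfolding union_balls_def by auto
    have r: "r > 0" using pos[OF cr(1)] by simp
    show "x \<in> union_balls (1 + 2 * s) G"
    proof (cases "(c, r) \<in> G")
      case True
      have "r \<le> (1 + 2 * s) * r" using r s by simp
      with cr(2) have "x \<in> ball c ((1 + 2 * s) * r)" by auto
      then show ?thesis using True unfolding union_balls_def by blast
    next
      case False
      have "union_balls 1 {g \<in> G. r \<le> snd g} \<in> sets lebesgue"
        using finG by (intro fmeasurableD lmeasurable_union_balls) simp
      from nearly_covered_ball_near[OF s cr(2) this] False G(3)[OF cr(1)]
      obtain u where u: "u \<in> union_balls 1 {g \<in> G. r \<le> snd g}" "dist u x < 2 * s * r" by blast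
      then obtain d \<rho> where d: "(d, \<rho>) \<in> G" "r \<le> \<rho>" "dist d u < \<rho>"
        by (auto simp: union_balls_def)
      have "dist d x \<le> dist d u + dist u x" by (rule dist_triangle)
      also have "\<dots> < \<rho> + 2 * s * r" using d u by simp
      also have "\<dots> \<le> (1 + 2 * s) * \<rho>" using d(2) s by (simp add: algebra_simps)
      finally have "x \<in> ball d ((1 + 2 * s) * \<rho>)" by simp
      then show ?thesis using d(1) unfolding union_balls_def by blast
    qed
  qed
  then have "?\<mu> (union_balls 1 F) \<le> ?\<mu> (union_balls (1 + 2 * s) G)"
    by (rule measure_mono_fmeasurable)
      (use lmeasurable_union_balls[OF F, of 1] lmeasurable_union_balls[OF finG, of "1 + 2 * s"] in auto)
  also have "\<dots> \<le> (1 + 2 * s) ^ DIM('a) * ?\<mu> (union_balls 1 G)"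
    using measure_union_balls_dilate[OF finG, of "1 + 2 * s"] pos G(1) s by auto
  finally have FG: "?\<mu> (union_balls 1 F) \<le> (1 + 2 * s) ^ DIM('a) * ?\<mu> (union_balls 1 G)" .
  have missing: "?\<mu> (ball c r - E) \<le> (1 - \<alpha>) * ?\<mu> (ball c r)" if "(c, r) \<in> G" for c r
  proof -
    have "?\<mu> (ball c r - E) = ?\<mu> (ball c r) - ?\<mu> (E \<inter> ball c r)"
      using measurable_measure_Diff[of "ball c r" lebesgue "E \<inter> ball c r"] E
      by (simp add: Diff_Int sets.Int fmeasurableD)
    then show ?thesis using dense[of c r] that G(1) by (auto simp: algebra_simps)
  qed
  have "?\<mu> (union_balls 1 G) - ?\<mu> E \<le> ?\<mu> (union_balls 1 G - E)"
  proof -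
    have "?\<mu> (union_balls 1 G) \<le> ?\<mu> (E \<union> (union_balls 1 G - E))"
      using E fmG by (intro measure_mono_fmeasurable) (auto intro!: fmeasurable.Un fmeasurable.Diff fmeasurableD)
    also have "\<dots> \<le> ?\<mu> E + ?\<mu> (union_balls 1 G - E)"
      using E fmG by (intro measure_Un_le) (auto intro!: sets.Diff fmeasurableD)
    finally show ?thesis by simp
  qed
  also have "union_balls 1 G - E = (\<Union>p\<in>G. ball (fst p) (snd p) - E)"
    by (auto simp: union_balls_def)
  also have "?\<mu> \<dots> \<le> (\<Sum>p\<in>G. ?\<mu> (ball (fst p) (snd p) - E))"
    using E by (intro measure_UNION_le[OF finG]) (auto intro!: sets.Diff fmeasurableD)
  also have "\<dots> \<le> (\<Sum>p\<in>G. (1 - \<alpha>) * ?\<mu> (ball (fst p) (snd p)))"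
    using missing by (intro sum_mono) auto
  also have "\<dots> = (1 - \<alpha>) * (\<Sum>(c, r)\<in>G. ?\<mu> (ball c r))"
    by (simp add: sum_distrib_left case_prod_unfold)
  also have "\<dots> \<le> (1 - \<alpha>) * (?\<mu> (union_balls 1 G) / s ^ DIM('a))"
    using G(2) s \<alpha> by (intro mult_left_mono) (auto simp: field_simps)
  finally have main: "(1 - (1 - \<alpha>) / s ^ DIM('a)) * ?\<mu> (union_balls 1 G) \<le> ?\<mu> E"
    by (simp add: algebra_simps)
  let ?k = "1 - (1 - \<alpha>) / s ^ DIM('a)"
  have "?k \<ge> 0" using loss s by (simp add: divide_le_eq)
  with FG have "?k * ?\<mu> (union_balls 1 F) \<le> ?k * ((1 + 2 * s) ^ DIM('a) * ?\<mu> (union_balls 1 G))"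
    by (rule mult_left_mono)
  also have "\<dots> = (1 + 2 * s) ^ DIM('a) * (?k * ?\<mu> (union_balls 1 G))" by (simp only: mult_ac)
  also have "\<dots> \<le> (1 + 2 * s) ^ DIM('a) * ?\<mu> E"
    using main s by (intro mult_left_mono) auto
  finally show ?thesis .
qed

lemma HL_maximal_indicator:
  fixes E :: "(real ^ 'n::finite) set"
  assumes E: "E \<in> sets lebesgue"
  shows "HL_maximal (indicator E) x =
    (SUP B \<in> {ball c r | c r. 0 < r \<and> x \<in> ball c r}. emeasure lebesgue (E \<inter> B) / emeasure lebesgue B)"
  unfolding HL_maximal_def
proof (rule SUP_cong[OF refl])
  fix B :: "(real ^ 'n) set" assume "B \<in> {ball c r | c r. 0 < r \<and> x \<in> ball c r}"
  then have B: "B \<in> sets lebesgue" by auto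
  have "(\<integral>\<^sup>+ y \<in> B. ennreal \<bar>indicator E y\<bar> \<partial>lebesgue) = (\<integral>\<^sup>+ y. indicator (E \<inter> B) y \<partial>lebesgue)"
    by (intro nn_integral_cong) (auto simp: indicator_def)
  then show "(\<integral>\<^sup>+ y \<in> B. ennreal \<bar>indicator E y\<bar> \<partial>lebesgue) / emeasure lebesgue B =
      emeasure lebesgue (E \<inter> B) / emeasure lebesgue B"
    using E B by (simp add: sets.Int)
qed

lemma measure_compact_subset_superlevel:
  fixes E :: "(real ^ 'n::finite) set"
  assumes E: "E \<in> lmeasurable" and \<alpha>: "0 < \<alpha>" "\<alpha> \<le> 1" and s: "0 < s" "s \<le> 1"
    and loss: "1 - \<alpha> \<le> s ^ CARD('n)" and K: "compact K" "K \<subseteq> HL_superlevel E \<alpha>"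
  shows "(1 - (1 - \<alpha>) / s ^ CARD('n)) * measure lebesgue K \<le> (1 + 2 * s) ^ CARD('n) * measure lebesgue E"
proof -
  have loss': "1 - (1 - \<alpha>) / s ^ CARD('n) \<ge> 0" using loss s by (simp add: divide_le_eq)
  define D where "D = {(c, r). 0 < r \<and> \<alpha> * measure lebesgue (ball c r) \<le> measure lebesgue (E \<inter> ball c r)}"
  have "\<exists>p\<in>D. x \<in> ball (fst p) (snd p)" if "x \<in> K" for x
  proof -
    have "ennreal \<alpha> < HL_maximal (indicator E) x" using that K(2) by (auto simp: HL_superlevel_def)
    then obtain c r where cr: "0 < r" "x \<in> ball c r"
      "ennreal \<alpha> < emeasure lebesgue (E \<inter> ball c r) / emeasure lebesgue (ball c r)"
      using E by (auto simp: HL_maximal_indicator[OF fmeasurableD[OF E]] less_SUP_iff)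
    have EB: "E \<inter> ball c r \<in> lmeasurable" using E by (intro fmeasurable.Int) auto
    have pos: "measure lebesgue (ball c r) > 0" using content_ball_pos[OF cr(1)] by simp
    have "emeasure lebesgue (E \<inter> ball c r) / emeasure lebesgue (ball c r)
        = ennreal (measure lebesgue (E \<inter> ball c r) / measure lebesgue (ball c r))"
      using pos by (simp only: emeasure_eq_measure2[OF EB] emeasure_eq_measure2[OF lmeasurable_ball]
          divide_ennreal measure_nonneg)
    then have "\<alpha> < measure lebesgue (E \<inter> ball c r) / measure lebesgue (ball c r)"
      using cr(3) \<alpha> by (simp add: ennreal_less_iff)
    then have "(c, r) \<in> D" using pos cr(1) by (simp add: D_def field_simps)
    with cr(2) show ?thesis by force
  qed
  then have "K \<subseteq> (\<Union>p\<in>D. ball (fst p) (snd p))" by blast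
  with K(1) obtain F where F: "F \<subseteq> D" "finite F" "K \<subseteq> (\<Union>p\<in>F. ball (fst p) (snd p))"
    by (elim compactE_image) auto
  have "measure lebesgue K \<le> measure lebesgue (union_balls 1 F)"
    using F K(1) lmeasurable_union_balls[OF F(2), of 1]
    by (intro measure_mono_fmeasurable) (auto simp: union_balls_def case_prod_unfold dest: lmeasurable_compact)
  then have "(1 - (1 - \<alpha>) / s ^ CARD('n)) * measure lebesgue K
      \<le> (1 - (1 - \<alpha>) / s ^ CARD('n)) * measure lebesgue (union_balls 1 F)"
    using loss' by (rule mult_left_mono)
  also have "\<dots> \<le> (1 + 2 * s) ^ CARD('n) * measure lebesgue E"
  proof -
    have "(1 - (1 - \<alpha>) / s ^ DIM(real ^ 'n)) * measure lebesgue (union_balls 1 F)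
        \<le> (1 + 2 * s) ^ DIM(real ^ 'n) * measure lebesgue E"
      by (rule measure_union_balls_dense_in) (use F E s \<alpha> loss in \<open>auto simp: D_def\<close>)
    then show ?thesis by simp
  qed
  finally show ?thesis .
qed

lemma emeasure_open_le_compact:
  fixes S :: "'a::euclidean_space set"
  assumes "open S" and le: "\<And>K. compact K \<Longrightarrow> K \<subseteq> S \<Longrightarrow> emeasure lebesgue K \<le> b"
  shows "emeasure lebesgue S \<le> b"
proof -
  obtain C :: "nat \<Rightarrow> 'a set" where C: "\<And>n. compact (C n)" "\<And>n. C n \<subseteq> S"
    "\<And>n. C n \<subseteq> interior (C (Suc n))" "\<Union> (range C) = S"
    using open_Union_compact_subsets[OF assms(1)] by metis
  have "incseq C" by (rule incseq_SucI) (use C(3) interior_subset in blast)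
  then have "(SUP n. emeasure lebesgue (C n)) = emeasure lebesgue S"
    unfolding C(4)[symmetric] using C(1)
    by (intro SUP_emeasure_incseq) (auto intro: fmeasurableD lmeasurable_compact)
  then show ?thesis using le[OF C(1,2)] by (metis SUP_least)
qed

text \<open>By convexity, the power lies below its chord over the unit interval, whose slope is \<open>2 ^ m - 1\<close>.\<close>
lemma power_le_chord:
  fixes x :: real
  assumes "0 \<le> x" "x \<le> 1"
  shows "(1 + x) ^ m \<le> 1 + 2 ^ m * x"
proof -
  have "(1 + x) ^ m \<le> 1 + (2 ^ m - 1) * x"
  proof (induction m)
    case (Suc m)
    have "(1 + x) ^ Suc m \<le> (1 + x) * (1 + (2 ^ m - 1) * x)"
      using Suc assms by (simp add: mult_left_mono)
    also have "\<dots> = 1 + 2 ^ m * x + (2 ^ m - 1) * (x * x)" by (simp add: algebra_simps)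
    also have "\<dots> \<le> 1 + 2 ^ m * x + (2 ^ m - 1) * x"
      using assms by (intro add_left_mono mult_left_mono) (auto simp: mult_left_le)
    finally show ?case by (simp add: algebra_simps)
  qed simp
  also have "\<dots> \<le> 1 + 2 ^ m * x" using assms by (simp add: algebra_simps)
  finally show ?thesis .
qed

text \<open>
  With this \<open>s\<close> the spill \<open>(1 - \<alpha>) / s\<^sup>n\<close> is at most \<open>s\<close>, and \<open>1 / (1 - s) \<le> 1 + 2 s\<close> for \<open>s \<le> 1 / 2\<close>, so
  both losses together cost at most \<open>n + 1\<close> factors \<open>1 + 2 s\<close>.
\<close>
lemma HL_tauberian_le:
  fixes \<alpha> :: real
  defines "s \<equiv> (1 / \<alpha> - 1) powr (1 / (real CARD('n) + 1))"
  assumes \<alpha>: "0 < \<alpha>" "\<alpha> < 1" and s_le: "s \<le> 1 / 2"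
  shows "HL_tauberian TYPE('n::finite) \<alpha> \<le> ennreal (1 + 2 ^ (CARD('n) + 2) * s)"
  unfolding HL_tauberian_def
proof (rule SUP_least)
  fix E :: "(real ^ 'n) set"
  assume "E \<in> {E. E \<in> sets lebesgue \<and> 0 < emeasure lebesgue E \<and> emeasure lebesgue E < \<infinity>}"
  then have E: "E \<in> lmeasurable" and Epos: "0 < emeasure lebesgue E" by (auto simp: fmeasurable_def)
  let ?n = "CARD('n)" and ?\<mu> = "measure (lebesgue :: (real ^ 'n) measure)"
  have \<delta>: "1 / \<alpha> - 1 > 0" using \<alpha> by (simp add: field_simps)
  then have s: "s > 0" using \<alpha> by (simp add: s_def)
  have "s ^ (?n + 1) = s powr (real ?n + 1)" using s by (simp add: powr_add powr_realpow)
  also have "\<dots> = (1 / \<alpha> - 1) powr 1" by (simp add: s_def powr_powr)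
  also have "\<dots> = 1 / \<alpha> - 1" using \<delta> by (intro powr_one) simp
  finally have s_pow: "s * s ^ ?n = 1 / \<alpha> - 1" by simp
  have "1 - \<alpha> = \<alpha> * (1 / \<alpha> - 1)" using \<alpha> by (simp add: field_simps)
  also have "\<dots> \<le> 1 * (1 / \<alpha> - 1)" using \<alpha> \<delta> by (intro mult_right_mono) auto
  finally have "1 - \<alpha> \<le> s * s ^ ?n" by (simp only: s_pow mult_1)
  then have loss: "(1 - \<alpha>) / s ^ ?n \<le> s" using s by (simp add: divide_le_eq)
  have "emeasure lebesgue (HL_superlevel E \<alpha>) \<le> ennreal ((1 + 2 ^ (?n + 2) * s) * ?\<mu> E)"
  proof (rule emeasure_open_le_compact[OF open_HL_superlevel])
    fix K assume K: "compact K" "K \<subseteq> HL_superlevel E \<alpha>"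
    have "(1 - s) * ?\<mu> K \<le> (1 - (1 - \<alpha>) / s ^ ?n) * ?\<mu> K"
      using loss by (intro mult_right_mono) auto
    also have "\<dots> \<le> (1 + 2 * s) ^ ?n * ?\<mu> E"
    proof (rule measure_compact_subset_superlevel[OF E \<alpha>(1) _ s _ _ K])
      have "(1 - \<alpha>) / s ^ ?n \<le> 1" using loss s_le by simp
      then show "1 - \<alpha> \<le> s ^ ?n" using s by (simp add: divide_le_eq)
    qed (use \<alpha> s_le in auto)
    finally have "(1 + 2 * s) * ((1 - s) * ?\<mu> K) \<le> (1 + 2 * s) * ((1 + 2 * s) ^ ?n * ?\<mu> E)"
      using s by (intro mult_left_mono) auto
    moreover have "1 * ?\<mu> K \<le> ((1 + 2 * s) * (1 - s)) * ?\<mu> K"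
    proof (rule mult_right_mono)
      have "0 \<le> s * (1 - 2 * s)" using s s_le by simp
      then show "1 \<le> (1 + 2 * s) * (1 - s)" by (simp add: algebra_simps)
    qed simp
    ultimately have "?\<mu> K \<le> (1 + 2 * s) ^ (?n + 1) * ?\<mu> E" by (simp add: mult.assoc)
    also have "\<dots> \<le> (1 + 2 ^ (?n + 1) * (2 * s)) * ?\<mu> E"
      using s s_le by (intro mult_right_mono power_le_chord) auto
    finally have "?\<mu> K \<le> (1 + 2 ^ (?n + 2) * s) * ?\<mu> E" by (simp add: mult_ac)
    then show "emeasure lebesgue K \<le> ennreal ((1 + 2 ^ (?n + 2) * s) * ?\<mu> E)"
      using lmeasurable_compact[OF K(1)] by (simp add: emeasure_eq_measure2 ennreal_leI)
  qed
  also have "\<dots> = emeasure lebesgue E * ennreal (1 + 2 ^ (?n + 2) * s)"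
    using E s by (simp add: emeasure_eq_measure2 ennreal_mult mult.commute)
  finally show "emeasure lebesgue (HL_superlevel E \<alpha>) / emeasure lebesgue E \<le> ennreal (1 + 2 ^ (?n + 2) * s)"
    using Epos by (intro divide_le_posI_ennreal)
qed

text \<open>If \<open>E\<close> is a ball, then \<open>E\<close> itself is admissible in the maximal function at each of its points and
  gives the average \<open>1 > \<alpha>\<close>. So \<open>E\<close> is contained in its superlevel set.\<close>
lemma HL_tauberian_ge_1:
  assumes \<alpha>: "\<alpha> < 1"
  shows "HL_tauberian TYPE('n::finite) \<alpha> \<ge> 1"
proof -
  let ?E = "ball 0 1 :: (real ^ 'n) set"
  have pos: "measure lebesgue ?E > 0" using content_ball_pos[of 1 "0 :: real ^ 'n"] by simp
  then have E: "emeasure lebesgue ?E \<noteq> 0" "emeasure lebesgue ?E < top"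
    by (simp_all only: emeasure_eq_measure2[OF lmeasurable_ball]) auto
  have "?E \<subseteq> HL_superlevel ?E \<alpha>"
  proof
    fix x assume x: "x \<in> ?E"
    have "ennreal \<alpha> < 1" using \<alpha> by (simp add: ennreal_less_one_iff)
    also have "1 = emeasure lebesgue (?E \<inter> ?E) / emeasure lebesgue ?E"
      using ennreal_divide_self[OF E] by simp
    also have "\<dots> \<le> HL_maximal (indicator ?E) x"
      unfolding HL_maximal_indicator[OF fmeasurableD[OF lmeasurable_ball]]
      using x by (intro SUP_upper) force
    finally show "x \<in> HL_superlevel ?E \<alpha>" by (simp add: HL_superlevel_def)
  qed
  then have "emeasure lebesgue ?E \<le> emeasure lebesgue (HL_superlevel ?E \<alpha>)"
    using open_HL_superlevel[of ?E \<alpha>] by (intro emeasure_mono) auto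
  then have "1 \<le> emeasure lebesgue (HL_superlevel ?E \<alpha>) / emeasure lebesgue ?E"
    using divide_right_mono_ennreal ennreal_divide_self[OF E] by metis
  also have "\<dots> \<le> HL_tauberian TYPE('n) \<alpha>"
    unfolding HL_tauberian_def using E by (intro SUP_upper) (auto simp: zero_less_iff_neq_zero)
  finally show ?thesis .
qed

theorem theorem3:
  shows "(HL_tauberian TYPE('n::finite) \<longlongrightarrow> 1) (at_left 1) \<and>
    (\<exists>c > 0. \<exists>\<alpha>\<^sub>0 \<in> {0<..<1}. \<forall>\<alpha> \<in> {\<alpha>\<^sub>0<..<1}.
       HL_tauberian TYPE('n) \<alpha> - 1 \<le>
         ennreal (c * (1 / \<alpha> - 1) powr (1 / (real CARD('n) + 1))))"
proof
  let ?n = "CARD('n)"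
  define s where "s \<alpha> = (1 / \<alpha> - 1) powr (1 / (real ?n + 1))" for \<alpha> :: real
  define c :: real where "c = 2 ^ (?n + 2)"
  \<comment> \<open>The value of \<open>\<alpha>\<close> at which \<open>s \<alpha>\<close> is \<open>1 / 2\<close>.\<close>
  define \<alpha>\<^sub>0 :: real where "\<alpha>\<^sub>0 = 1 / (1 + (1 / 2) powr (real ?n + 1))"
  have \<alpha>\<^sub>0: "\<alpha>\<^sub>0 \<in> {0<..<1}" 
  proof -
    have "0 < (1 / 2 :: real) powr (real ?n + 1)" by simp
    then have "1 < 1 + (1 / 2 :: real) powr (real ?n + 1)" by linarith
    then show ?thesis unfolding \<alpha>\<^sub>0_def by (simp del: powr_gt_zero)
  qed
  have upper: "HL_tauberian TYPE('n) \<alpha> \<le> ennreal (1 + c * s \<alpha>)" if "\<alpha> \<in> {\<alpha>\<^sub>0<..<1}" for \<alpha>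
  proof -
    have \<alpha>: "0 < \<alpha>" "\<alpha> < 1" "\<alpha>\<^sub>0 < \<alpha>" using that \<alpha>\<^sub>0 by auto
    have "1 / \<alpha> \<le> 1 / \<alpha>\<^sub>0" using \<alpha> \<alpha>\<^sub>0 by (simp add: frac_le)
    then have "1 / \<alpha> - 1 \<le> (1 / 2) powr (real ?n + 1)" by (simp add: \<alpha>\<^sub>0_def)
    then have "s \<alpha> \<le> ((1 / 2) powr (real ?n + 1)) powr (1 / (real ?n + 1))"
      unfolding s_def using \<alpha> by (intro powr_mono2) auto
    also have "\<dots> = 1 / 2" by (simp add: powr_powr)
    finally show ?thesis
      using HL_tauberian_le[where 'n = 'n, OF \<alpha>(1,2)] by (simp add: s_def c_def)
  qed
  have "eventually (\<lambda>\<alpha>. \<alpha> \<in> {\<alpha>\<^sub>0<..<1}) (at_left 1)"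
    using \<alpha>\<^sub>0 by (intro eventually_at_left_real) auto
  then have ev: "eventually (\<lambda>\<alpha>. HL_tauberian TYPE('n) \<alpha> \<le> ennreal (1 + c * s \<alpha>)) (at_left 1)"
    "eventually (\<lambda>\<alpha>. 1 \<le> HL_tauberian TYPE('n) \<alpha>) (at_left 1)"
    by (auto elim!: eventually_mono intro: upper HL_tauberian_ge_1)
  have "((\<lambda>\<alpha>. (1 / \<alpha> - 1) powr (1 / (real ?n + 1))) \<longlongrightarrow> (1 / 1 - 1) powr (1 / (real ?n + 1))) (at_left 1)"
  proof (rule tendsto_powr')
    have "\<forall>\<^sub>F \<alpha> :: real in at_left 1. 0 \<le> 1 / \<alpha> - 1"
      using eventually_at_left_real[of 0 "1 :: real"] by (auto elim!: eventually_mono)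
    then show "1 / 1 - 1 \<noteq> (0 :: real) \<or>
        0 < 1 / (real ?n + 1) \<and> (\<forall>\<^sub>F \<alpha> :: real in at_left 1. 0 \<le> 1 / \<alpha> - 1)"
      by (auto intro: add_nonneg_pos)
  qed (auto intro!: tendsto_eq_intros)
  then have "(s \<longlongrightarrow> 0) (at_left 1)" by (simp add: s_def[abs_def])
  then have "((\<lambda>\<alpha>. ennreal (1 + c * s \<alpha>)) \<longlongrightarrow> ennreal (1 + c * 0)) (at_left 1)"
    by (intro tendsto_intros)
  then show "(HL_tauberian TYPE('n) \<longlongrightarrow> 1) (at_left 1)"
    by (intro tendsto_sandwich[OF ev(2,1) tendsto_const]) simp
  have "HL_tauberian TYPE('n) \<alpha> - 1 \<le> ennreal (c * s \<alpha>)" if "\<alpha> \<in> {\<alpha>\<^sub>0<..<1}" for \<alpha>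
    using upper[OF that] by (simp add: ennreal_minus_le_iff c_def s_def)
  moreover have "c > 0" by (simp add: c_def)
  ultimately show "\<exists>c > 0. \<exists>\<alpha>\<^sub>0 \<in> {0<..<1}. \<forall>\<alpha> \<in> {\<alpha>\<^sub>0<..<1}.
      HL_tauberian TYPE('n) \<alpha> - 1 \<le> ennreal (c * (1 / \<alpha> - 1) powr (1 / (real ?n + 1)))"
    using \<alpha>\<^sub>0 unfolding s_def by blast
qed

end
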